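(* Let $m=4k-2$ with $k\ge 1$ an integer, let $C_m$ be the cyclic biquandle of order $m$, let $n\ge 1$ and let $y\in C_m$. For $z\in C_m$ put $$A_{2n+1,z}=\sum_{a_1,\ldots,a_n\in C_m}(z,a_1,a_1,a_2,a_2,\ldots,a_n,a_n)\in C_{2n+1}^{YB}(C_m),$$ which is a $(2n+1)$-cycle. Then the homology class $[A_{2n+1,y}-A_{2n+1,y+1}]\in H^{YB}_{2n+1}(C_m)$ is non-trivial and belongs to the torsion subgroup of $H^{YB}_{2n+1}(C_m)$.
   Context: The cyclic biquandle $C_m$ of order $m$ is the set $\mathbb{Z}/m\mathbb{Z}$ with the map $R(a,b)=(b+1,a-1)$. Its set-theoretic Yang-Baxter chain complex: for $n\ge 1$, $C_n^{YB}(C_m)$ is the free abelian group with basis $(C_m)^n$, and $C_n^{YB}(C_m)=0$ for $n\le 0$. The boundary is $\partial_n=\sum_{i=1}^n(-1)^{i-1}(d^l_{i,n}-d^r_{i,n})$ for $n\ge 2$ (and $\partial_n=0$ for $n\le 1$), where on basis elements $$d^l_{i,n}(x_1,\ldots,x_n)=(x_1-1,\ldots,x_{i-1}-1,x_{i+1},\ldots,x_n),$$ $$d^r_{i,n}(x_1,\ldots,x_n)=(x_1,\ldots,x_{i-1},x_{i+1}+1,\ldots,x_n+1).$$ $H_n^{YB}(C_m)$ is the $n$th homology group of this complex of abelian groups. *)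

theory Defs
  imports "HOL-Algebra.Algebra"
begin

section \<open>The cyclic biquandle\<close>

text \<open>The elements of \<open>\<int>/m\<int>\<close> are represented by the integers in \<open>{0..<m}\<close>.\<close>

definition cyclic_carrier :: "int \<Rightarrow> int set"
  where "cyclic_carrier m = {0..<m}"

definition cyclic_R :: "int \<Rightarrow> int \<times> int \<Rightarrow> int \<times> int"
  where "cyclic_R m = (\<lambda>(a, b). ((b + 1) mod m, (a - 1) mod m))"


section \<open>Its set-theoretic Yang-Baxter chain complex\<close>

text \<open>The tuple \<open>(x\<^sub>1,\<dots>,x\<^sub>n)\<close> is the list with entries \<open>x\<^sub>i = xs ! (i - 1)\<close>.\<close>

definition YB_tuples :: "int \<Rightarrow> nat \<Rightarrow> int list set"
  where "YB_tuples m n = {xs. length xs = n \<and> set xs \<subseteq> cyclic_carrier m}"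

text \<open>Only degrees \<open>n \<ge> 0\<close> are represented. The chain group in degree \<open>0\<close> is zero, not the free
  abelian group on the empty tuple.\<close>

definition YB_chain_group :: "int \<Rightarrow> nat \<Rightarrow> (int list \<Rightarrow>\<^sub>0 int) monoid"
  where "YB_chain_group m n = free_Abelian_group (if n = 0 then {} else YB_tuples m n)"

definition YB_face_l :: "int \<Rightarrow> nat \<Rightarrow> int list \<Rightarrow> int list"
  where "YB_face_l m i xs = map (\<lambda>a. (a - 1) mod m) (take (i - 1) xs) @ drop i xs"

definition YB_face_r :: "int \<Rightarrow> nat \<Rightarrow> int list \<Rightarrow> int list"
  where "YB_face_r m i xs = take (i - 1) xs @ map (\<lambda>a. (a + 1) mod m) (drop i xs)"

text \<open>The shifts in the faces are the action of \<open>R\<close> on the entries that \<open>x\<^sub>i\<close> is moved past;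
  for this \<open>R\<close> the result does not depend on the value of the moving entry.\<close>

lemma YB_face_l_cyclic_R:
  "YB_face_l m i xs = map (\<lambda>a. snd (cyclic_R m (a, b))) (take (i - 1) xs) @ drop i xs"
  by (simp add: YB_face_l_def cyclic_R_def)

lemma YB_face_r_cyclic_R:
  "YB_face_r m i xs = take (i - 1) xs @ map (\<lambda>a. fst (cyclic_R m (b, a))) (drop i xs)"
  by (simp add: YB_face_r_def cyclic_R_def)

definition YB_boundary :: "int \<Rightarrow> nat \<Rightarrow> (int list \<Rightarrow>\<^sub>0 int) \<Rightarrow> (int list \<Rightarrow>\<^sub>0 int)"
  where "YB_boundary m n c =
    (if n \<le> 1 then 0
     else frag_extend
       (\<lambda>xs. \<Sum>i = 1..n. frag_cmul ((-1) ^ (i - 1))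
                (frag_of (YB_face_l m i xs) - frag_of (YB_face_r m i xs))) c)"

definition YB_cycles :: "int \<Rightarrow> nat \<Rightarrow> (int list \<Rightarrow>\<^sub>0 int) set"
  where "YB_cycles m n =
    kernel (YB_chain_group m n) (YB_chain_group m (n - 1)) (YB_boundary m n)"

definition YB_boundaries :: "int \<Rightarrow> nat \<Rightarrow> (int list \<Rightarrow>\<^sub>0 int) set"
  where "YB_boundaries m n = YB_boundary m (Suc n) ` carrier (YB_chain_group m (Suc n))"

definition YB_cycle_group :: "int \<Rightarrow> nat \<Rightarrow> (int list \<Rightarrow>\<^sub>0 int) monoid"
  where "YB_cycle_group m n = (YB_chain_group m n) \<lparr>carrier := YB_cycles m n\<rparr>"

definition YB_homology :: "int \<Rightarrow> nat \<Rightarrow> (int list \<Rightarrow>\<^sub>0 int) set monoid"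
  where "YB_homology m n = YB_cycle_group m n Mod YB_boundaries m n"

definition YB_class :: "int \<Rightarrow> nat \<Rightarrow> (int list \<Rightarrow>\<^sub>0 int) \<Rightarrow> (int list \<Rightarrow>\<^sub>0 int) set"
  where "YB_class m n c = YB_boundaries m n #>\<^bsub>YB_cycle_group m n\<^esub> c"

definition torsion_subgroup :: "('a, 'b) monoid_scheme \<Rightarrow> 'a set"
  where "torsion_subgroup G = {x \<in> carrier G. \<exists>N::nat. N > 0 \<and> x [^]\<^bsub>G\<^esub> N = \<one>\<^bsub>G\<^esub>}"


section \<open>The chains \<open>A\<^bsub>2n+1,z\<^esub>\<close>\<close>

definition YB_A :: "int \<Rightarrow> nat \<Rightarrow> int \<Rightarrow> (int list \<Rightarrow>\<^sub>0 int)"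
  where "YB_A m n z = (\<Sum>as \<in> YB_tuples m n. frag_of (z # concat (map (\<lambda>a. [a, a]) as)))"

end

theory Submission
  imports Defs
begin

text \<open>With \<open>T\<close> the shift of all entries by \<open>1\<close>, the right faces are \<open>T\<close> applied to the left ones, so the
  boundary is \<open>1 - T\<close> times an alternating face sum. That face sum is, up to the substitution
  \<open>u\<^sub>i = x\<^sub>i + i\<close> and \<open>T\<close>, the boundary of the full ordered simplex on \<open>\<int>/m\<close>, and the \<open>T\<close>-coinvariants of the latter
  compute the homology of the group \<open>\<int>/m\<close>. Let \<open>G\<close> be the \<open>n\<close>-th cup power of the carry cocycle
  generating \<open>H\<^sup>2(\<int>/m; \<int>)\<close>. As \<open>G\<close> is a \<open>T\<close>-invariant integral cocycle, \<open>x \<mapsto> x\<^sub>1 G(x)\<close> vanishes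
  modulo \<open>m\<close> on boundaries, while it takes the value \<open>z\<close> on \<open>A\<^sub>z\<close>; so \<open>A\<^sub>y - A\<^bsub>y+1\<^esub>\<close> is not a boundary.
  It is torsion because the boundary of \<open>\<Sum>\<^sub>a (u, v, a\<^sub>1, a\<^sub>1, \<dots>, a\<^sub>n, a\<^sub>n)\<close> is
  \<open>(A\<^sub>v - A\<^bsub>v+1\<^esub>) - (A\<^bsub>u-1\<^esub> - A\<^sub>u)\<close>: all \<open>m\<close> of the differences are homologous, and their sum is zero.\<close>

section \<open>A cocycle modulo \<open>m\<close>\<close>

text \<open>In the coordinates \<open>u\<^sub>i = x\<^sub>i + i\<close> this is the carry \<open>([v - u] + [w - v] - [w - u]) / m\<close> of residues.\<close>

definition carry :: "int \<Rightarrow> int \<Rightarrow> int \<Rightarrow> int \<Rightarrow> int"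
  where "carry m x y z = ((y - x + 1) mod m + (z - y + 1) mod m - (z - x + 2) mod m) div m"

text \<open>Cup power of the carry cocycle: neighbouring factors share an entry, as the last vertex
  of one cup factor is the first of the next. A list of length 2n+1 yields n factors.\<close>

fun carry_prod :: "int \<Rightarrow> int list \<Rightarrow> int" where
  "carry_prod m (x # y # z # r) = carry m x y z * carry_prod m (z # r)"
| "carry_prod m _ = 1"

text \<open>The division in \<open>carry\<close> is exact: modulo \<open>m\<close> the differences
  cancel, and so do the constants, 1 + 1 - 2 = 0.\<close>

lemma mult_carry:
  "m * carry m x y z = (y - x + 1) mod m + (z - y + 1) mod m - (z - x + 2) mod m"
proof -
  have "((y - x + 1) mod m + (z - y + 1) mod m - (z - x + 2) mod m) mod m
      = ((y - x + 1) + (z - y + 1) - (z - x + 2)) mod m"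
    by (intro mod_diff_cong mod_add_cong) simp_all
  also have "\<dots> = 0"
    by simp
  finally have "m dvd (y - x + 1) mod m + (z - y + 1) mod m - (z - x + 2) mod m"
    by (rule mod_0_imp_dvd)
  then show ?thesis
    unfolding carry_def by (rule dvd_mult_div_cancel)
qed

text \<open>Normal forms for differences of entries of right faces: a common shift cancels, a shift
  of the later entry alone moves into the constant.\<close>

lemma shifted_diff_mod:
  fixes a b c m :: int
  shows "((b + 1) mod m - (a + 1) mod m + c) mod m = (b - a + c) mod m"
    "((b + 1) mod m - a + c) mod m = (b - a + (c + 1)) mod m"
proof -
  have "((b + 1) mod m - (a + 1) mod m + c) mod m = ((b + 1) - (a + 1) + c) mod m"
    by (intro mod_diff_cong mod_add_cong) simp_all
  then show "((b + 1) mod m - (a + 1) mod m + c) mod m = (b - a + c) mod m"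
    by simp
  have "((b + 1) mod m - a + c) mod m = ((b + 1) - a + c) mod m"
    by (intro mod_diff_cong mod_add_cong) simp_all
  then show "((b + 1) mod m - a + c) mod m = (b - a + (c + 1)) mod m"
    by (simp add: algebra_simps)
qed

lemma carry_shift: "carry m ((x + 1) mod m) ((y + 1) mod m) ((z + 1) mod m) = carry m x y z"
proof -
  show ?thesis unfolding carry_def shifted_diff_mod(1) by (rule refl)
qed

lemma carry_prod_shift: "carry_prod m (map (\<lambda>a. (a + 1) mod m) xs) = carry_prod m xs"
  by (induction m xs rule: carry_prod.induct) (simp_all add: carry_shift)

lemma carry_cocycle:
  assumes "m \<noteq> 0"
  shows "carry m x1 x2 x3 - carry m x0 ((x2 + 1) mod m) ((x3 + 1) mod m)
    + carry m x0 x1 ((x3 + 1) mod m) - carry m x0 x1 x2 = 0"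
proof -
  have "m * (carry m x1 x2 x3 - carry m x0 ((x2 + 1) mod m) ((x3 + 1) mod m)
    + carry m x0 x1 ((x3 + 1) mod m) - carry m x0 x1 x2) = 0"
    \<comment> \<open>The first rule must be exhausted before the second, whose left side also
      matches differences with both entries shifted. The twelve residues then cancel in
      pairs.\<close>
    unfolding distrib_left right_diff_distrib mult_carry shifted_diff_mod(1) unfolding shifted_diff_mod(2) by simp
  then show ?thesis using assms by simp
qed

lemma YB_face_r_Cons:
  "YB_face_r m (Suc 0) (x # xs) = map (\<lambda>a. (a + 1) mod m) xs"
  "YB_face_r m (Suc (Suc i)) (x # xs) = x # YB_face_r m (Suc i) xs"
  by (simp_all add: YB_face_r_def)

text \<open>Leibniz rule for the cup product, by splitting off the first factor. Right faces
  suffice, since \<open>carry_prod\<close> is invariant under the shift.\<close>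

lemma carry_prod_cocycle:
  assumes "m \<noteq> 0" "length xs = 2 * n + 2"
  shows "(\<Sum>i<length xs. (-1) ^ i * carry_prod m (YB_face_r m (Suc i) xs)) = 0"
  using assms(2)
proof (induction n arbitrary: xs)
  case 0
  then obtain x y where "xs = [x, y]"
    by (auto simp: length_Suc_conv numeral_2_eq_2)
  then show ?case by (simp add: YB_face_r_Cons)
next
  case (Suc n)
  then have "length xs = Suc (Suc (Suc (Suc (2 * n))))" by simp
  then obtain x0 x1 x2 x3 r where xs: "xs = x0 # x1 # x2 # x3 # r" and r: "length r = 2 * n"
    by (auto simp: length_Suc_conv)
  let ?g = "carry_prod m (x3 # r)"
  let ?f = "\<lambda>i. YB_face_r m (Suc (Suc i)) (x2 # x3 # r)"
  have shift: "carry_prod m (((x3 + 1) mod m) # map (\<lambda>a. (a + 1) mod m) r) = ?g"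
    using carry_prod_shift[of m "x3 # r"] by simp
  have "(\<Sum>i<length (x2 # x3 # r). (-1) ^ i * carry_prod m (YB_face_r m (Suc i) (x2 # x3 # r))) = 0"
    using r by (intro Suc.IH) simp
  then have "?g - (\<Sum>i<Suc (length r). (-1) ^ i * carry_prod m (?f i)) = 0"
    by (simp add: sum.lessThan_Suc_shift YB_face_r_Cons shift sum_negf del: sum.lessThan_Suc)
  \<comment> \<open>The face deleting \<open>x2\<close> is moved to the other side; the remaining
    faces are those on which the first factor stays \<open>carry m x0 x1 x2\<close>.\<close>
  then have IH: "(\<Sum>i<Suc (length r). (-1) ^ i * carry_prod m (?f i)) = ?g"
    by simp
  define k where "k = Suc (length r)"
  have len: "length xs = Suc (Suc (Suc k))"
    by (simp add: xs k_def)
  have "(\<Sum>i<length xs. (-1) ^ i * carry_prod m (YB_face_r m (Suc i) xs))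
    = carry m x1 x2 x3 * ?g - carry m x0 ((x2 + 1) mod m) ((x3 + 1) mod m) * ?g
      + (carry m x0 x1 ((x3 + 1) mod m) * ?g
         - carry m x0 x1 x2 * (\<Sum>i<k. (-1) ^ i * carry_prod m (?f i)))"
    unfolding len sum.lessThan_Suc_shift
    by (simp add: xs YB_face_r_Cons shift carry_shift sum_distrib_left sum_negf mult.left_commute)
  also have "\<dots> = (carry m x1 x2 x3 - carry m x0 ((x2 + 1) mod m) ((x3 + 1) mod m)
    + carry m x0 x1 ((x3 + 1) mod m) - carry m x0 x1 x2) * ?g"
    unfolding k_def IH by (simp add: algebra_simps)
  also have "\<dots> = 0"
    unfolding carry_cocycle[OF assms(1)] by simp
  finally show ?case .
qed

section \<open>Values of the cochain on boundaries, modulo \<open>m\<close>\<close>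

lemma YB_face_r_eq_shift_YB_face_l:
  assumes "set xs \<subseteq> cyclic_carrier m"
  shows "YB_face_r m i xs = map (\<lambda>a. (a + 1) mod m) (YB_face_l m i xs)"
proof -
  \<comment> \<open>Lowering and raising an entry restores it because entries are reduced
    representatives.\<close>
  have "((a - 1) mod m + 1) mod m = a" if "a \<in> set (take (i - 1) xs)" for a
    using that assms by (auto simp: mod_simps cyclic_carrier_def dest: in_set_takeD)
  then show ?thesis
    by (simp add: YB_face_r_def YB_face_l_def map_idI)
qed

definition YB_cochain :: "int \<Rightarrow> int list \<Rightarrow> int"
  where "YB_cochain m xs = hd xs * carry_prod m xs"

text \<open>Pairing of a cochain with a chain. The integers are realised as the free abelian group
  on the single generator \<open>()\<close>, so that linearity comes from
  \<open>frag_extend\<close>.\<close>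

definition frag_eval :: "('a \<Rightarrow> int) \<Rightarrow> ('a \<Rightarrow>\<^sub>0 int) \<Rightarrow> int"
  where "frag_eval f c = Poly_Mapping.lookup (frag_extend (\<lambda>x. frag_cmul (f x) (frag_of ())) c) ()"

lemma frag_eval_simps [simp]:
  "frag_eval f 0 = 0"
  "frag_eval f (frag_of x) = f x"
  "frag_eval f (a + b) = frag_eval f a + frag_eval f b"
  "frag_eval f (a - b) = frag_eval f a - frag_eval f b"
  "frag_eval f (frag_cmul k a) = k * frag_eval f a"
  by (simp_all add: frag_eval_def frag_extend_add frag_extend_diff frag_extend_cmul
      Poly_Mapping.lookup_add Poly_Mapping.lookup_minus)

lemma frag_eval_sum: "frag_eval f (\<Sum>i\<in>I. g i) = (\<Sum>i\<in>I. frag_eval f (g i))"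
  by (induction I rule: infinite_finite_induct) simp_all

lemma YB_boundary_frag_of:
  assumes "n \<ge> 2"
  shows "YB_boundary m n (frag_of xs) =
    (\<Sum>i<n. frag_cmul ((-1) ^ i) (frag_of (YB_face_l m (Suc i) xs) - frag_of (YB_face_r m (Suc i) xs)))"
proof -
  have "{1..n} = Suc ` {..<n}"
    by (simp add: image_Suc_lessThan)
  then show ?thesis
    using assms by (simp add: YB_boundary_def sum.reindex)
qed

lemma YB_boundary_simps [simp]:
  "YB_boundary m n 0 = 0"
  "YB_boundary m n (a + b) = YB_boundary m n a + YB_boundary m n b"
  "YB_boundary m n (a - b) = YB_boundary m n a - YB_boundary m n b"
  by (simp_all add: YB_boundary_def frag_extend_add frag_extend_diff)

lemma YB_boundary_sum: "YB_boundary m n (\<Sum>i\<in>I. g i) = (\<Sum>i\<in>I. YB_boundary m n (g i))"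
  by (induction I rule: infinite_finite_induct) simp_all

text \<open>A right face is the shift of the left one. The shift fixes \<open>carry_prod\<close> and
  raises the head by 1 modulo \<open>m\<close>, so each left-minus-right difference is
  \<open>- carry_prod\<close> modulo \<open>m\<close>; the alternating sum of these vanishes by the
  cocycle identity.\<close>

lemma YB_cochain_boundary:
  assumes m: "m \<noteq> 0" and xs: "xs \<in> YB_tuples m (2 * n + 2)"
  shows "m dvd frag_eval (YB_cochain m) (YB_boundary m (2 * n + 2) (frag_of xs))"
proof -
  have len: "length xs = 2 * n + 2" and sub: "set xs \<subseteq> cyclic_carrier m"
    using xs by (auto simp: YB_tuples_def)
  let ?g = "\<lambda>i. YB_cochain m (YB_face_l m (Suc i) xs) - YB_cochain m (YB_face_r m (Suc i) xs)"
  let ?c = "\<lambda>i. carry_prod m (YB_face_r m (Suc i) xs)"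
  have face: "m dvd ?g i + ?c i" if "i < 2 * n + 2" for i
  proof -
    let ?l = "YB_face_l m (Suc i) xs"
    have r: "YB_face_r m (Suc i) xs = map (\<lambda>a. (a + 1) mod m) ?l"
      by (rule YB_face_r_eq_shift_YB_face_l[OF sub])
    have "length ?l = 2 * n + 1"
      using len that by (simp add: YB_face_l_def)
    then have "?l \<noteq> []" by auto
    then have "?g i + ?c i = ((hd ?l + 1) - (hd ?l + 1) mod m) * carry_prod m ?l"
      unfolding r YB_cochain_def carry_prod_shift by (simp add: hd_map algebra_simps)
    then show ?thesis
      by (simp only: minus_mod_eq_mult_div mult.assoc dvd_triv_left)
  qed
  have "frag_eval (YB_cochain m) (YB_boundary m (2 * n + 2) (frag_of xs))
    = (\<Sum>i<2 * n + 2. (-1) ^ i * ?g i)"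
    by (subst YB_boundary_frag_of) (simp, simp only: frag_eval_sum frag_eval_simps)
  also have "\<dots> = (\<Sum>i<2 * n + 2. (-1) ^ i * (?g i + ?c i)) - (\<Sum>i<2 * n + 2. (-1) ^ i * ?c i)"
    by (simp only: distrib_left sum.distrib add_diff_cancel_right')
  also have "(\<Sum>i<2 * n + 2. (-1) ^ i * ?c i) = 0"
    using carry_prod_cocycle[OF m len] by (simp only: len)
  also have "m dvd (\<Sum>i<2 * n + 2. (-1) ^ i * (?g i + ?c i)) - 0"
    unfolding diff_zero by (intro dvd_sum dvd_mult face) simp
  finally show ?thesis .
qed

lemma YB_cochain_boundaries:
  assumes "m \<noteq> 0" "c \<in> YB_boundaries m (2 * n + 1)"
  shows "m dvd frag_eval (YB_cochain m) c"
proof -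
  obtain e where c: "c = YB_boundary m (2 * n + 2) e" and e: "Poly_Mapping.keys e \<subseteq> YB_tuples m (2 * n + 2)"
    using assms(2) by (auto simp: YB_boundaries_def YB_chain_group_def carrier_free_Abelian_group_iff)
  have "m dvd frag_eval (YB_cochain m) (YB_boundary m (2 * n + 2) e)"
    using e
    by (induction e rule: frag_induction)
      (use YB_cochain_boundary[OF assms(1)] in \<open>auto simp: dvd_diff\<close>)
  then show ?thesis by (simp add: c)
qed

section \<open>The chains \<open>A\<^sub>z\<close>\<close>

lemma finite_YB_tuples [simp]: "finite (YB_tuples m n)"
proof -
  have "YB_tuples m n = {xs. set xs \<subseteq> {0..<m} \<and> length xs = n}"
    by (auto simp: YB_tuples_def cyclic_carrier_def)
  then show ?thesis by (simp add: finite_lists_length_eq)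
qed

lemma YB_tuples_0: "YB_tuples m 0 = {[]}"
  by (auto simp: YB_tuples_def)

lemma sum_YB_tuples_Suc:
  "(\<Sum>as\<in>YB_tuples m (Suc n). f as) = (\<Sum>a\<in>cyclic_carrier m. \<Sum>as\<in>YB_tuples m n. f (a # as))"
proof -
  have "YB_tuples m (Suc n) = (\<lambda>(a, as). a # as) ` (cyclic_carrier m \<times> YB_tuples m n)"
    by (auto simp: YB_tuples_def length_Suc_conv image_iff)
  moreover have "inj_on (\<lambda>(a, as). a # as) (cyclic_carrier m \<times> YB_tuples m n)"
    by (auto simp: inj_on_def)
  ultimately show ?thesis
    by (simp add: sum.reindex sum.cartesian_product case_prod_unfold)
qed

lemma bij_betw_cyclic_shift: "m > 0 \<Longrightarrow> bij_betw (\<lambda>a. (a + s) mod m) (cyclic_carrier m) (cyclic_carrier m)"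
  by (rule bij_betw_byWitness[where f' = "\<lambda>a. (a - s) mod m"])
    (auto simp: cyclic_carrier_def mod_simps)

text \<open>In \<open>m\<close> times the sum, the first and third residues each run once through
  all of \<open>cyclic_carrier m\<close> and cancel. The middle one is \<open>1 mod m\<close>, which
  is 1 as \<open>m \<ge> 2\<close>, and contributes \<open>m\<close> in total.\<close>

lemma sum_carry_diag:
  assumes "m \<ge> 2"
  shows "(\<Sum>a\<in>cyclic_carrier m. carry m x a a) = 1"
proof -
  have shift: "(\<Sum>a\<in>cyclic_carrier m. (a + s) mod m) = \<Sum>(cyclic_carrier m)" for s
    using sum.reindex_bij_betw[OF bij_betw_cyclic_shift[of m s], of "\<lambda>a. a"] assms by simp
  have "m * (\<Sum>a\<in>cyclic_carrier m. carry m x a a)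
    = (\<Sum>a\<in>cyclic_carrier m. (a + (1 - x)) mod m + 1 - (a + (2 - x)) mod m)"
    unfolding sum_distrib_left mult_carry using assms by (simp add: algebra_simps)
  also have "\<dots> = m"
    unfolding sum_subtractf sum.distrib shift using assms by (simp add: cyclic_carrier_def)
  finally show ?thesis using assms by simp
qed

section \<open>Cancellation between the two faces of each pair\<close>

abbreviation pairs :: "'a list \<Rightarrow> 'a list"
  where "pairs as \<equiv> concat (map (\<lambda>a. [a, a]) as)"

lemma bij_betw_YB_tuples_shift:
  assumes "m > 0"
  shows "bij_betw (map (\<lambda>a. (a + s) mod m)) (YB_tuples m n) (YB_tuples m n)"
  by (rule bij_betw_byWitness[where f' = "map (\<lambda>a. (a - s) mod m)"])
    (use assms in \<open>auto simp: YB_tuples_def cyclic_carrier_def mod_simps subset_iff intro!: map_idI\<close>)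

lemma bij_betw_YB_tuples_update:
  assumes "m > 0" "j < n"
  shows "bij_betw (\<lambda>as. as[j := (as ! j + s) mod m]) (YB_tuples m n) (YB_tuples m n)"
proof (rule bij_betw_byWitness[where f' = "\<lambda>as. as[j := (as ! j - s) mod m]"])
  show "\<forall>as\<in>YB_tuples m n. as[j := (as ! j + s) mod m,
      j := (as[j := (as ! j + s) mod m] ! j - s) mod m] = as"
    "\<forall>as\<in>YB_tuples m n. as[j := (as ! j - s) mod m,
      j := (as[j := (as ! j - s) mod m] ! j + s) mod m] = as"
    using assms by (auto simp: YB_tuples_def cyclic_carrier_def mod_simps subset_iff)
  show "(\<lambda>as. as[j := (as ! j + s) mod m]) ` YB_tuples m n \<subseteq> YB_tuples m n"
    "(\<lambda>as. as[j := (as ! j - s) mod m]) ` YB_tuples m n \<subseteq> YB_tuples m n"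
    using assms by (auto simp: YB_tuples_def cyclic_carrier_def dest!: set_update_subset_insert[THEN subsetD])
qed

lemma length_pairs: "length (pairs as) = 2 * length as"
  by (induction as) simp_all

lemma take_drop_pairs:
  assumes "j < length as"
  shows "take (2 * j) (pairs as) = pairs (take j as)"
    "take (Suc (2 * j)) (pairs as) = pairs (take j as) @ [as ! j]"
    "drop (Suc (2 * j)) (pairs as) = as ! j # pairs (drop (Suc j) as)"
    "drop (Suc (Suc (2 * j))) (pairs as) = pairs (drop (Suc j) as)"
proof -
  have as: "pairs as = pairs (take j as) @ [as ! j, as ! j] @ pairs (drop (Suc j) as)"
    by (subst id_take_nth_drop[OF assms]) simp
  have len: "length (pairs (take j as)) = 2 * j"
    using assms by (simp add: length_pairs)
  show "take (2 * j) (pairs as) = pairs (take j as)"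
    "take (Suc (2 * j)) (pairs as) = pairs (take j as) @ [as ! j]"
    "drop (Suc (2 * j)) (pairs as) = as ! j # pairs (drop (Suc j) as)"
    "drop (Suc (Suc (2 * j))) (pairs as) = pairs (drop (Suc j) as)"
    unfolding as take_append drop_append len by (simp_all add: len)
qed

text \<open>Deleting one copy of an entry shifts the other copy in exactly one of the two cases, so
  the two faces differ only by a substitution in \<open>as ! j\<close>. Summation over all tuples
  absorbs it.\<close>

lemma YB_face_pairs:
  assumes "j < length as" "p' = length p"
  shows "YB_face_l m (Suc (p' + Suc (2 * j))) (p @ pairs as)
      = YB_face_l m (Suc (p' + 2 * j)) (p @ pairs (as[j := (as ! j + (-1)) mod m]))"
    "YB_face_r m (Suc (p' + 2 * j)) (p @ pairs as)
      = YB_face_r m (Suc (p' + Suc (2 * j))) (p @ pairs (as[j := (as ! j + 1) mod m]))"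
  using assms by (simp_all add: YB_face_l_def YB_face_r_def take_drop_pairs)

lemma sum_alternating_pairs:
  fixes f :: "nat \<Rightarrow> 'a \<Rightarrow>\<^sub>0 int"
  assumes "\<And>j. j < n \<Longrightarrow> f (q + 2 * j) = f (q + Suc (2 * j))"
  shows "(\<Sum>i<q + 2 * n. frag_cmul ((-1) ^ i) (f i)) = (\<Sum>i<q. frag_cmul ((-1) ^ i) (f i))"
  using assms
  by (induction n) (simp_all flip: frag_cmul_distrib)

text \<open>The two positions of a pair carry opposite signs and, after summation, equal faces. Only
  deletions inside the prefix \<open>p\<close> survive.\<close>

lemma YB_boundary_pairs:
  assumes "m > 0" "length p + 2 * n \<ge> 2"
  shows "YB_boundary m (length p + 2 * n) (\<Sum>as\<in>YB_tuples m n. frag_of (p @ pairs as))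
    = (\<Sum>i<length p. frag_cmul ((-1) ^ i)
        ((\<Sum>as\<in>YB_tuples m n. frag_of (YB_face_l m (Suc i) (p @ pairs as)))
         - (\<Sum>as\<in>YB_tuples m n. frag_of (YB_face_r m (Suc i) (p @ pairs as)))))"
proof -
  let ?q = "length p"
  define l where "l i = (\<Sum>as\<in>YB_tuples m n. frag_of (YB_face_l m (Suc i) (p @ pairs as)))" for i
  define r where "r i = (\<Sum>as\<in>YB_tuples m n. frag_of (YB_face_r m (Suc i) (p @ pairs as)))" for i
  have len: "length as = n" if "as \<in> YB_tuples m n" for as
    using that by (simp add: YB_tuples_def)
  have l: "l (?q + 2 * j) = l (?q + Suc (2 * j))" if j: "j < n" for j
  proof -
    have "l (?q + Suc (2 * j)) = (\<Sum>as\<in>YB_tuples m n. frag_of (YB_face_l m (Suc (?q + 2 * j))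
        (p @ pairs (as[j := (as ! j + (-1)) mod m]))))"
      unfolding l_def using j by (intro sum.cong refl) (simp only: YB_face_pairs(1) len)
    also have "\<dots> = l (?q + 2 * j)"
      unfolding l_def by (rule sum.reindex_bij_betw[OF bij_betw_YB_tuples_update[OF assms(1) j]])
    finally show ?thesis ..
  qed
  have r: "r (?q + 2 * j) = r (?q + Suc (2 * j))" if j: "j < n" for j
  proof -
    have "r (?q + 2 * j) = (\<Sum>as\<in>YB_tuples m n. frag_of (YB_face_r m (Suc (?q + Suc (2 * j)))
        (p @ pairs (as[j := (as ! j + 1) mod m]))))"
      unfolding r_def using j by (intro sum.cong refl) (simp only: YB_face_pairs(2) len)
    also have "\<dots> = r (?q + Suc (2 * j))"
      unfolding r_def by (rule sum.reindex_bij_betw[OF bij_betw_YB_tuples_update[OF assms(1) j]])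
    finally show ?thesis .
  qed
  have "YB_boundary m (?q + 2 * n) (\<Sum>as\<in>YB_tuples m n. frag_of (p @ pairs as))
    = (\<Sum>as\<in>YB_tuples m n. \<Sum>i<?q + 2 * n. frag_cmul ((-1) ^ i)
        (frag_of (YB_face_l m (Suc i) (p @ pairs as)) - frag_of (YB_face_r m (Suc i) (p @ pairs as))))"
    by (simp only: YB_boundary_sum YB_boundary_frag_of[OF assms(2)])
  also have "\<dots> = (\<Sum>i<?q + 2 * n. frag_cmul ((-1) ^ i) (l i - r i))"
    by (subst sum.swap) (simp only: l_def r_def frag_cmul_sum flip: sum_subtractf)
  also have "\<dots> = (\<Sum>i<?q. frag_cmul ((-1) ^ i) (l i - r i))"
    by (rule sum_alternating_pairs) (simp only: l r)
  finally show ?thesis by (simp only: l_def r_def)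
qed

lemma YB_boundary_A:
  assumes "m > 0" "n \<ge> 1"
  shows "YB_boundary m (2 * n + 1) (YB_A m n z) = 0"
proof -
  \<comment> \<open>Only the deletion of \<open>z\<close> remains; its right face shifts every pair,
    which merely permutes the tuples summed over.\<close>
  have "(\<Sum>as\<in>YB_tuples m n. frag_of (pairs (map (\<lambda>a. (a + 1) mod m) as)))
    = (\<Sum>as\<in>YB_tuples m n. frag_of (pairs as))"
    by (rule sum.reindex_bij_betw[OF bij_betw_YB_tuples_shift[OF assms(1)]])
  then show ?thesis
    using YB_boundary_pairs[of m "[z]" n] assms
    by (simp add: YB_A_def YB_face_l_def YB_face_r_def map_concat comp_def)
qed

lemma YB_boundary_two_pairs:
  assumes "m > 0"
  shows "YB_boundary m (2 * n + 2) (\<Sum>as\<in>YB_tuples m n. frag_of (u # v # pairs as))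
    = (YB_A m n v - YB_A m n ((v + 1) mod m)) - (YB_A m n ((u - 1) mod m) - YB_A m n u)"
proof -
  have shift: "(\<Sum>as\<in>YB_tuples m n. frag_of (w # concat (map (\<lambda>a. [(a + 1) mod m, (a + 1) mod m]) as)))
    = YB_A m n w" for w
    using sum.reindex_bij_betw[OF bij_betw_YB_tuples_shift[OF assms],
        of "\<lambda>as. frag_of (w # pairs as)"]
    by (simp add: YB_A_def comp_def)
  show ?thesis
    using YB_boundary_pairs[of m "[u, v]" n] assms
    by (simp add: YB_face_l_def YB_face_r_def map_concat comp_def shift)
      (simp add: YB_A_def)
qed

lemma frag_eval_A:
  assumes "m \<ge> 2"
  shows "frag_eval (YB_cochain m) (YB_A m n z) = z"
proof -
  \<comment> \<open>Splitting off the first pair \<open>a, a\<close> leaves \<open>a\<close> as the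
    new head, hence the induction over arbitrary \<open>p\<close>. The inner sum is 1, and the sum
    over \<open>a\<close> is \<open>sum_carry_diag\<close>.\<close>
  have "(\<Sum>as\<in>YB_tuples m n. carry_prod m (p # pairs as)) = 1" for p
    by (induction n arbitrary: p)
      (simp_all add: YB_tuples_0 sum_YB_tuples_Suc sum_carry_diag[OF assms] flip: sum_distrib_left)
  then show ?thesis
    by (simp add: YB_A_def frag_eval_sum YB_cochain_def flip: sum_distrib_left)
qed

section \<open>Homology classes\<close>

lemma YB_boundaries_closed:
  "0 \<in> YB_boundaries m n"
  "a \<in> YB_boundaries m n \<Longrightarrow> b \<in> YB_boundaries m n \<Longrightarrow> a + b \<in> YB_boundaries m n"
  "a \<in> YB_boundaries m n \<Longrightarrow> b \<in> YB_boundaries m n \<Longrightarrow> a - b \<in> YB_boundaries m n"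
proof -
  show "0 \<in> YB_boundaries m n"
    unfolding YB_boundaries_def
    by (rule image_eqI[of _ _ 0]) (simp_all add: YB_chain_group_def)
  assume "a \<in> YB_boundaries m n" "b \<in> YB_boundaries m n"
  then obtain a' b' where ab: "a = YB_boundary m (Suc n) a'" "b = YB_boundary m (Suc n) b'"
    "Poly_Mapping.keys a' \<subseteq> YB_tuples m (Suc n)" "Poly_Mapping.keys b' \<subseteq> YB_tuples m (Suc n)"
    by (auto simp: YB_boundaries_def YB_chain_group_def)
  show "a + b \<in> YB_boundaries m n"
    unfolding YB_boundaries_def
    by (rule image_eqI[of _ _ "a' + b'"])
      (use ab keys_add[of a' b'] in \<open>auto simp: YB_chain_group_def\<close>)
  show "a - b \<in> YB_boundaries m n"
    unfolding YB_boundaries_def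
    by (rule image_eqI[of _ _ "a' - b'"])
      (use ab keys_diff[of a' b'] in \<open>auto simp: YB_chain_group_def\<close>)
qed

lemma YB_boundaries_sum:
  "(\<And>i. i \<in> I \<Longrightarrow> g i \<in> YB_boundaries m n) \<Longrightarrow> (\<Sum>i\<in>I. g i) \<in> YB_boundaries m n"
  by (induction I rule: infinite_finite_induct) (auto simp: YB_boundaries_closed)

lemma YB_class_eq: "YB_class m n c = (\<lambda>h. h + c) ` YB_boundaries m n"
  by (auto simp: YB_class_def r_coset_def YB_cycle_group_def YB_chain_group_def)

text \<open>The unit of the quotient is the set of boundaries itself; the coset contains
  \<open>c = 0 + c\<close>, and closure under sums and differences gives the converse.\<close>

lemma YB_class_eq_one_iff: "YB_class m n c = \<one>\<^bsub>YB_homology m n\<^esub> \<longleftrightarrow> c \<in> YB_boundaries m n"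
proof
  assume "YB_class m n c = \<one>\<^bsub>YB_homology m n\<^esub>"
  then have "(\<lambda>h. h + c) ` YB_boundaries m n = YB_boundaries m n"
    by (simp add: YB_class_eq YB_homology_def FactGroup_def)
  moreover have "c \<in> (\<lambda>h. h + c) ` YB_boundaries m n"
    using YB_boundaries_closed(1) by (rule rev_image_eqI) simp
  ultimately show "c \<in> YB_boundaries m n" by simp
next
  assume "c \<in> YB_boundaries m n"
  then have "(\<lambda>h. h + c) ` YB_boundaries m n = YB_boundaries m n"
    by (auto simp: YB_boundaries_closed intro: image_eqI[of _ _ "x - c" for x])
  then show "YB_class m n c = \<one>\<^bsub>YB_homology m n\<^esub>"
    by (simp add: YB_class_eq YB_homology_def FactGroup_def)
qed

text \<open>The quotient multiplies cosets as sets: boundaries add up in one direction, and 0 serves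
  as the second boundary in the other.\<close>

lemma YB_class_mult:
  "YB_class m n a \<otimes>\<^bsub>YB_homology m n\<^esub> YB_class m n b = YB_class m n (a + b)"
proof -
  have "\<exists>h\<in>YB_boundaries m n. (h1 + a) + (h2 + b) = h + (a + b)"
    if "h1 \<in> YB_boundaries m n" "h2 \<in> YB_boundaries m n" for h1 h2
    using YB_boundaries_closed(2)[OF that] by (intro bexI[of _ "h1 + h2"]) simp_all
  moreover have "\<exists>h1\<in>YB_boundaries m n. \<exists>h2\<in>YB_boundaries m n. h + (a + b) = (h1 + a) + (h2 + b)"
    if "h \<in> YB_boundaries m n" for h
    using that YB_boundaries_closed(1) by (intro bexI[of _ h] bexI[of _ 0]) simp_all
  ultimately show ?thesis
    by (auto simp: YB_class_eq YB_homology_def FactGroup_def set_mult_def YB_cycle_group_def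
        YB_chain_group_def image_iff)
qed

lemma YB_class_pow:
  "YB_class m n c [^]\<^bsub>YB_homology m n\<^esub> N = YB_class m n (frag_cmul (int N) c)"
proof (induction N)
  case 0
  have "YB_class m n 0 = \<one>\<^bsub>YB_homology m n\<^esub>"
    by (simp add: YB_class_eq_one_iff YB_boundaries_closed)
  then show ?case by (simp add: nat_pow_def)
next
  case (Suc N)
  have "YB_class m n c [^]\<^bsub>YB_homology m n\<^esub> Suc N
    = YB_class m n (frag_cmul (int N) c) \<otimes>\<^bsub>YB_homology m n\<^esub> YB_class m n c"
    using Suc.IH by (simp add: nat_pow_def)
  also have "\<dots> = YB_class m n (frag_cmul (int (Suc N)) c)"
    by (simp add: YB_class_mult frag_cmul_distrib add.commute)
  finally show ?case .
qed

lemma YB_class_in_carrier: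
  "c \<in> YB_cycles m n \<Longrightarrow> YB_class m n c \<in> carrier (YB_homology m n)"
  by (auto simp: YB_homology_def FactGroup_def RCOSETS_def YB_class_def YB_cycle_group_def)

lemma YB_A_in_cycles:
  assumes "m > 0" "n \<ge> 1" "z \<in> cyclic_carrier m"
  shows "YB_A m n z \<in> YB_cycles m (2 * n + 1)"
proof -
  have "z # pairs as \<in> YB_tuples m (2 * n + 1)" if "as \<in> YB_tuples m n" for as
    using that assms(3) by (auto simp: YB_tuples_def length_pairs)
  then have "YB_A m n z \<in> carrier (YB_chain_group m (2 * n + 1))"
    unfolding YB_A_def YB_chain_group_def by (intro sum_closed_free_Abelian_group) simp
  then show ?thesis
    using YB_boundary_A[OF assms(1,2)] by (simp add: YB_cycles_def kernel_def YB_chain_group_def)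
qed

lemma YB_cycles_diff:
  assumes "a \<in> YB_cycles m n" "b \<in> YB_cycles m n"
  shows "a - b \<in> YB_cycles m n"
  using assms keys_diff[of a b] by (auto simp: YB_cycles_def kernel_def YB_chain_group_def split: if_splits)

section \<open>Torsion and non-triviality of the difference class\<close>

lemma frag_cmul_A_diff_in_boundaries:
  assumes "m > 0" "y \<in> cyclic_carrier m"
  shows "frag_cmul m (YB_A m n y - YB_A m n ((y + 1) mod m)) \<in> YB_boundaries m (2 * n + 1)"
proof -
  let ?d = "\<lambda>z. YB_A m n z - YB_A m n ((z + 1) mod m)"
  have "?d y - ?d z \<in> YB_boundaries m (2 * n + 1)" if z: "z \<in> cyclic_carrier m" for z
  proof -
    \<comment> \<open>Chosen so that the second bracket of \<open>YB_boundary_two_pairs\<close>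
      becomes \<open>?d z\<close>.\<close>
    let ?u = "(z + 1) mod m"
    let ?e = "\<Sum>as\<in>YB_tuples m n. frag_of (?u # y # pairs as)"
    have "?u \<in> cyclic_carrier m"
      using assms(1) by (simp add: cyclic_carrier_def)
    then have "?u # y # pairs as \<in> YB_tuples m (2 * n + 2)" if "as \<in> YB_tuples m n" for as
      using that assms(2) by (auto simp: YB_tuples_def length_pairs)
    then have "?e \<in> carrier (YB_chain_group m (2 * n + 2))"
      unfolding YB_chain_group_def by (intro sum_closed_free_Abelian_group) simp
    moreover have "(?u - 1) mod m = z"
      using z by (simp add: mod_simps cyclic_carrier_def)
    then have "YB_boundary m (2 * n + 2) ?e = ?d y - ?d z"
      using YB_boundary_two_pairs[OF assms(1), of n ?u y] by simp
    ultimately show ?thesis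
      unfolding YB_boundaries_def by force
  qed
  then have "(\<Sum>z\<in>cyclic_carrier m. ?d y - ?d z) \<in> YB_boundaries m (2 * n + 1)"
    by (rule YB_boundaries_sum)
  \<comment> \<open>The sum telescopes around the cycle.\<close>
  moreover have "(\<Sum>z\<in>cyclic_carrier m. ?d z) = 0"
    using sum.reindex_bij_betw[OF bij_betw_cyclic_shift[OF assms(1), of 1], of "YB_A m n"]
    by (simp add: sum_subtractf)
  moreover have "(\<Sum>z\<in>cyclic_carrier m. c) = frag_cmul m c" for c :: "int list \<Rightarrow>\<^sub>0 int"
  proof -
    have "(\<Sum>z\<in>S. c) = frag_cmul (int (card S)) c" if "finite S" for S :: "int set"
      using that by (induction S) (simp_all add: frag_cmul_distrib)
    then show ?thesis
      using assms(1) by (simp add: cyclic_carrier_def)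
  qed
  ultimately show ?thesis
    by (simp add: sum_subtractf[of "\<lambda>_. ?d y"])
qed

theorem theorem3p16:
  fixes k m y :: int and n :: nat
  assumes "k \<ge> 1" and "m = 4 * k - 2" and "n \<ge> 1" and "y \<in> cyclic_carrier m"
  shows "(\<forall>z \<in> cyclic_carrier m. YB_A m n z \<in> YB_cycles m (2 * n + 1)) \<and>
    YB_class m (2 * n + 1) (YB_A m n y - YB_A m n ((y + 1) mod m))
      \<noteq> \<one>\<^bsub>YB_homology m (2 * n + 1)\<^esub> \<and>
    YB_class m (2 * n + 1) (YB_A m n y - YB_A m n ((y + 1) mod m))
      \<in> torsion_subgroup (YB_homology m (2 * n + 1))"
proof -
  have m: "m \<ge> 2" using assms(1,2) by simp
  let ?d = "YB_A m n y - YB_A m n ((y + 1) mod m)"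
  have cycles: "\<forall>z \<in> cyclic_carrier m. YB_A m n z \<in> YB_cycles m (2 * n + 1)"
    using YB_A_in_cycles m assms(3) by simp
  have "(y + 1) mod m \<in> cyclic_carrier m"
    using m by (simp add: cyclic_carrier_def)
  then have d: "?d \<in> YB_cycles m (2 * n + 1)"
    using cycles assms(4) by (intro YB_cycles_diff) simp_all
  have "?d \<notin> YB_boundaries m (2 * n + 1)"
  proof
    assume "?d \<in> YB_boundaries m (2 * n + 1)"
    \<comment> \<open>The cochain takes the value \<open>y - (y + 1) mod m\<close> on the
      difference, which is -1 modulo \<open>m\<close>.\<close>
    then have "m dvd y - (y + 1) mod m"
      using YB_cochain_boundaries[of m ?d n] m by (simp add: frag_eval_A)
    moreover have "m dvd (y + 1) - (y + 1) mod m"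
      by (simp only: minus_mod_eq_mult_div dvd_triv_left)
    ultimately have "m dvd ((y + 1) - (y + 1) mod m) - (y - (y + 1) mod m)"
      by (rule dvd_diff[rotated])
    then have "m dvd 1" by simp
    then show False using m by simp
  qed
  \<comment> \<open>The order \<open>m\<close> of the biquandle serves as torsion exponent.\<close>
  moreover have "YB_class m (2 * n + 1) ?d [^]\<^bsub>YB_homology m (2 * n + 1)\<^esub> nat m
    = \<one>\<^bsub>YB_homology m (2 * n + 1)\<^esub>"
    using frag_cmul_A_diff_in_boundaries[of m y n] m assms(4)
    by (simp add: YB_class_pow YB_class_eq_one_iff)
  then have "YB_class m (2 * n + 1) ?d \<in> torsion_subgroup (YB_homology m (2 * n + 1))"
    unfolding torsion_subgroup_def using YB_class_in_carrier[OF d] m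
    by (auto intro!: exI[of _ "nat m"])
  ultimately show ?thesis
    using cycles by (simp add: YB_class_eq_one_iff)
qed

end
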